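(* Let $n\ge2$, let $\lambda\in\mathbb C$ be non-zero, and let $d=(d_1,\dots,d_n)\in\mathbb R^n$. Define the linear functional $\Psi_d'$ on $\mathcal S(M_n(\mathbb R)[t^{-1}]t^{-1})_\lambda$ by $$\Psi_d'(f)=\int f\left(X_{-1},X_{-2},0,0,\dots\right)\,e^{2\pi i\left(d_1\frac{x_{-1}^{2,2}}{x_{-1}^{2,1}}+\cdots+d_{n-1}\frac{x_{-1}^{n,n}}{x_{-1}^{n,n-1}}+d_n\frac{x_{-1}^{1,1}}{x_{-2}^{1,n}}\right)}\,dx,$$ where $X_{-1}$ is the upper Hessenberg matrix with $(p,q)$-entry $x_{-1}^{p,q}$ for $p\le q+1$ and $0$ for $p>q+1$, $X_{-2}$ is the matrix whose only non-zero entry is the $(1,n)$-entry $x_{-2}^{1,n}$, and the integral is with respect to Lebesgue measure over all the real variables $x_{-1}^{p,q}$ ($p\le q+1$) and $x_{-2}^{1,n}$. Then $\Psi_d'$ is a Whittaker functional for the second copy of $\widehat{SL_n}(F)$: for every $v\in SL_n(\mathbb R[[t]])$ with $v(0)$ lower triangular unipotent and every $f\in\mathcal S(M_n(\mathbb R)[t^{-1}]t^{-1})_\lambda$, $$(\pi_2^*(v)\Psi_d')(f)=\hat\chi_d(v)\,\Psi_d'(f),\qquad \hat\chi_d(v)=e^{-2\pi i(d_1v_1+\cdots+d_{n-1}v_{n-1}+d_nz_n)},$$ where $v_1,\dots,v_{n-1}$ are the subdiagonal entries of $v(0)$ ($v_k$ being the $(k+1,k)$-entry) and $z_n$ is the $(1,n)$-entry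 of $v'(0)$, the coefficient of $t$ in $v$.
   Context: $F=\mathbb R((t))$, $M_n(\mathbb R)$ is the space of real $n\times n$ matrices. An element of $M_n(\mathbb R)[t^{-1}]t^{-1}$ is written $x=\sum_{i\ge1}x_{-i}t^{-i}$ with $x_{-i}\in M_n(\mathbb R)$ (finitely many non-zero), and functions on it are written $f(x_{-1},x_{-2},\dots)$; $x_{-i}^{p,q}$ is the $(p,q)$-entry of $x_{-i}$. $\mathcal S(M_n(\mathbb R)[t^{-1}]t^{-1})$ is the space of complex-valued functions whose restriction to every finite-dimensional subspace is a Schwartz function, and $\mathcal S(M_n(\mathbb R)[t^{-1}]t^{-1})_\lambda$ is the subspace of $f$ with $\int_{M_n(\mathbb R)}f(y,x_{-1},x_{-2},\dots)\,dy=\lambda f(x_{-1},x_{-2},\dots)$. Functions on $M_n(\mathbb R)[t^{-1}]t^{-1}$ are extended to functions on $M_n(F)$ periodic under $M_n(\mathbb R[[t]])$ by pulling back along the projection $M_n(F)\to M_n(\mathbb R)[t^{-1}]t^{-1}$. This space carries an action of $\widehat{SL_n}(F)\times\widehat{SL_n}(F)$ (central extensions of the loop group $SL_n(F)$) coming from $x\mapsto g_1xg_2^T$; the restriction of the action $\pi_2$ of the second copy to $v\in SL_n(\mathbb R[[t]])$ (over which the extension is canonically split) is $\pi_2(v)f(x)=f(x(v^{-1})^T)$. The dual action on linear functionals is $(\pi_2^*(v)\Psi)(f)=\Psi(\pi_2(v)^{-1}f)$. *)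

theory Defs
  imports
    "HOL-Analysis.Analysis"
    "HOL-Computational_Algebra.Formal_Laurent_Series"
    "Jordan_Normal_Form.Determinant"
begin

text \<open>
  \<open>F\<close> is the field \<open>real fls\<close>, \<open>M_n(F)\<close> is the set \<open>carrier_mat n n\<close> of matrices over it, and
  matrix and vector indices start at \<open>0\<close>: the \<open>(p,q)\<close>-entry in the usual numbering is the entry at
  \<open>(p - 1, q - 1)\<close>.
\<close>

no_notation vec_nth (infixl \<open>$\<close> 90)
no_notation fls_nth (infixl \<open>$$\<close> 75)


subsection \<open>The space of polar parts\<close>

definition polar_part :: "real fls \<Rightarrow> real fls" where
  "polar_part a = a - fps_to_fls (fls_regpart a)"

definition polar_matrices :: "nat \<Rightarrow> real fls mat set" where
  "polar_matrices n =
     {x \<in> carrier_mat n n. \<forall>p<n. \<forall>q<n. fls_regpart (x $$ (p, q)) = 0}"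

text \<open>The matrix \<open>A t\<^sup>-\<^sup>k\<close> for a real matrix \<open>A\<close>.\<close>

definition polar_monom :: "nat \<Rightarrow> real mat \<Rightarrow> real fls mat" where
  "polar_monom k A = fls_X_inv ^ k \<cdot>\<^sub>m map_mat fls_const A"

text \<open>
  A function on \<open>polar_matrices n\<close> is represented by a total function on \<open>real fls mat\<close> whose values
  outside \<open>polar_matrices n\<close> play no role.  The next function is its extension to \<open>M_n(F)\<close>, periodic
  under matrices of power series.
\<close>

definition periodic_extension :: "(real fls mat \<Rightarrow> complex) \<Rightarrow> real fls mat \<Rightarrow> complex" where
  "periodic_extension f x = f (map_mat polar_part x)"


subsection \<open>Schwartz functions\<close>

text \<open>
  A function on \<open>\<real>\<^sup>k\<close> is represented by a function of \<open>c :: nat \<Rightarrow> real\<close> that depends only on the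
  coordinates \<open>c 0, \<dots>, c (k - 1)\<close>.  Continuity then refers to the product topology on
  \<open>nat \<Rightarrow> real\<close>, which for such functions is the same as continuity on \<open>\<real>\<^sup>k\<close>.
\<close>

definition partial_deriv :: "nat \<Rightarrow> ((nat \<Rightarrow> real) \<Rightarrow> complex) \<Rightarrow> (nat \<Rightarrow> real) \<Rightarrow> complex" where
  "partial_deriv i g c = vector_derivative (\<lambda>s. g (c(i := s))) (at (c i))"

definition iter_partial :: "nat list \<Rightarrow> ((nat \<Rightarrow> real) \<Rightarrow> complex) \<Rightarrow> (nat \<Rightarrow> real) \<Rightarrow> complex" where
  "iter_partial js g = foldr partial_deriv js g"

definition smooth_coords :: "nat \<Rightarrow> ((nat \<Rightarrow> real) \<Rightarrow> complex) \<Rightarrow> bool" where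
  "smooth_coords k g \<longleftrightarrow>
     (\<forall>js \<in> lists {..<k}.
        continuous_on UNIV (iter_partial js g) \<and>
        (\<forall>i<k. \<forall>c. (\<lambda>s. iter_partial js g (c(i := s))) differentiable (at (c i))))"

definition schwartz_coords :: "nat \<Rightarrow> ((nat \<Rightarrow> real) \<Rightarrow> complex) \<Rightarrow> bool" where
  "schwartz_coords k g \<longleftrightarrow>
     smooth_coords k g \<and>
     (\<forall>js \<in> lists {..<k}. \<forall>m :: nat \<Rightarrow> nat.
        bounded (range (\<lambda>c. complex_of_real (\<Prod>i<k. c i ^ m i) * iter_partial js g c)))"

text \<open>The real linear combination \<open>c 0 b 0 + \<dots> + c (k - 1) b (k - 1)\<close> of \<open>n \<times> n\<close> matrices over \<open>F\<close>.\<close>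

definition lincomb_mat ::
  "nat \<Rightarrow> nat \<Rightarrow> (nat \<Rightarrow> real fls mat) \<Rightarrow> (nat \<Rightarrow> real) \<Rightarrow> real fls mat" where
  "lincomb_mat n k b c = mat n n (\<lambda>(p, q). \<Sum>i<k. fls_const (c i) * b i $$ (p, q))"

definition real_independent :: "nat \<Rightarrow> nat \<Rightarrow> (nat \<Rightarrow> real fls mat) \<Rightarrow> bool" where
  "real_independent n k b \<longleftrightarrow>
     (\<forall>c. lincomb_mat n k b c = 0\<^sub>m n n \<longrightarrow> (\<forall>i<k. c i = 0))"

text \<open>
  A finite-dimensional subspace is given by a basis \<open>b 0, \<dots>, b (k - 1)\<close>; the restriction of \<open>f\<close> to
  it is Schwartz if it is so in the coordinates of that basis.
\<close>

definition schwartz_space :: "nat \<Rightarrow> (real fls mat \<Rightarrow> complex) set" where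
  "schwartz_space n =
     {f. \<forall>k b. (\<forall>i<k. b i \<in> polar_matrices n) \<and> real_independent n k b
           \<longrightarrow> schwartz_coords k (\<lambda>c. f (lincomb_mat n k b c))}"

text \<open>
  In terms of the coefficient sequences, \<open>prepend_coeff n y x\<close> is
  \<open>(y, x\<^sub>-\<^sub>1, x\<^sub>-\<^sub>2, \<dots>)\<close>, that is \<open>y t\<^sup>-\<^sup>1 + t\<^sup>-\<^sup>1 x\<close>.
\<close>

definition prepend_coeff :: "nat \<Rightarrow> (nat \<times> nat \<Rightarrow> real) \<Rightarrow> real fls mat \<Rightarrow> real fls mat" where
  "prepend_coeff n y x = polar_monom 1 (mat n n y) + fls_X_inv \<cdot>\<^sub>m x"

definition schwartz_eigenspace :: "nat \<Rightarrow> complex \<Rightarrow> (real fls mat \<Rightarrow> complex) set" where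
  "schwartz_eigenspace n lam =
     {f \<in> schwartz_space n. \<forall>x \<in> polar_matrices n.
        (LINT y | PiM ({..<n} \<times> {..<n}) (\<lambda>_. lborel). f (prepend_coeff n y x)) = lam * f x}"

definition linear_functional_on ::
  "(real fls mat \<Rightarrow> complex) set \<Rightarrow> ((real fls mat \<Rightarrow> complex) \<Rightarrow> complex) \<Rightarrow> bool" where
  "linear_functional_on S \<Psi> \<longleftrightarrow>
     (\<forall>f\<in>S. \<forall>g\<in>S. \<forall>a b. \<Psi> (\<lambda>x. a * f x + b * g x) = a * \<Psi> f + b * \<Psi> g)"


subsection \<open>The action of the second copy of \<open>SL_n\<close>\<close>

definition SL_fps :: "nat \<Rightarrow> real fps mat set" where
  "SL_fps n = {v \<in> carrier_mat n n. det v = 1}"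

definition inverse_mat :: "nat \<Rightarrow> real fps mat \<Rightarrow> real fps mat" where
  "inverse_mat n v = (THE w. w \<in> carrier_mat n n \<and> inverts_mat v w \<and> inverts_mat w v)"

definition pi2 ::
  "nat \<Rightarrow> real fps mat \<Rightarrow> (real fls mat \<Rightarrow> complex) \<Rightarrow> real fls mat \<Rightarrow> complex" where
  "pi2 n v f = (\<lambda>x. periodic_extension f (x * transpose_mat (map_mat fps_to_fls (inverse_mat n v))))"

text \<open>\<open>\<pi>\<^sub>2(v)\<^sup>-\<^sup>1\<close> is the operator \<open>\<pi>\<^sub>2(v\<^sup>-\<^sup>1)\<close>.\<close>

definition pi2_dual ::
  "nat \<Rightarrow> real fps mat \<Rightarrow> ((real fls mat \<Rightarrow> complex) \<Rightarrow> complex)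
     \<Rightarrow> (real fls mat \<Rightarrow> complex) \<Rightarrow> complex" where
  "pi2_dual n v \<Psi> f = \<Psi> (pi2 n (inverse_mat n v) f)"

definition coeff_mat :: "nat \<Rightarrow> real fps mat \<Rightarrow> real mat" where
  "coeff_mat j v = map_mat (\<lambda>a. fps_nth a j) v"

definition lower_unipotent :: "real mat \<Rightarrow> bool" where
  "lower_unipotent A \<longleftrightarrow>
     (\<forall>p < dim_row A. \<forall>q < dim_col A. (p < q \<longrightarrow> A $$ (p, q) = 0) \<and> (p = q \<longrightarrow> A $$ (p, q) = 1))"


subsection \<open>The functional and the character\<close>

text \<open>
  The integration variable \<open>x\<^sub>-\<^sub>i\<^sup>p\<^sup>,\<^sup>q\<close> has the index \<open>(i, p - 1, q - 1)\<close>.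
\<close>

definition hess_vars :: "nat \<Rightarrow> (nat \<times> nat \<times> nat) set" where
  "hess_vars n = {(1, p, q) | p q. p < n \<and> q < n \<and> p \<le> q + 1} \<union> {(2, 0, n - 1)}"

definition hess_point :: "nat \<Rightarrow> (nat \<times> nat \<times> nat \<Rightarrow> real) \<Rightarrow> real fls mat" where
  "hess_point n x =
     polar_monom 1 (mat n n (\<lambda>(p, q). if p \<le> q + 1 then x (1, p, q) else 0)) +
     polar_monom 2 (mat n n (\<lambda>(p, q). if p = 0 \<and> q = n - 1 then x (2, p, q) else 0))"

text \<open>
  Where a denominator vanishes (a null set) the quotient has the value \<open>0\<close>.
\<close>

definition whittaker_phase :: "nat \<Rightarrow> real vec \<Rightarrow> (nat \<times> nat \<times> nat \<Rightarrow> real) \<Rightarrow> real" where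
  "whittaker_phase n d x =
     (\<Sum>k<n - 1. d $ k * (x (1, k + 1, k + 1) / x (1, k + 1, k)))
       + d $ (n - 1) * (x (1, 0, 0) / x (2, 0, n - 1))"

definition Psi_integrand ::
  "nat \<Rightarrow> real vec \<Rightarrow> (real fls mat \<Rightarrow> complex) \<Rightarrow> (nat \<times> nat \<times> nat \<Rightarrow> real) \<Rightarrow> complex" where
  "Psi_integrand n d f x =
     f (hess_point n x) * exp (2 * complex_of_real pi * \<i> * complex_of_real (whittaker_phase n d x))"

definition Psi' :: "nat \<Rightarrow> real vec \<Rightarrow> (real fls mat \<Rightarrow> complex) \<Rightarrow> complex" where
  "Psi' n d f = (LINT x | PiM (hess_vars n) (\<lambda>_. lborel). Psi_integrand n d f x)"

definition chi_hat :: "nat \<Rightarrow> real vec \<Rightarrow> real fps mat \<Rightarrow> complex" where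
  "chi_hat n d v =
     exp (- 2 * complex_of_real pi * \<i> * complex_of_real
       ((\<Sum>k<n - 1. d $ k * coeff_mat 0 v $$ (k + 1, k))
          + d $ (n - 1) * coeff_mat 1 v $$ (0, n - 1)))"

end

theory Submission
  imports Defs "HOL-Probability.Sinc_Integral"
begin

text \<open>
  Since \<open>\<pi>\<^sub>2(v)\<^sup>-\<^sup>1 f\<close> is \<open>x \<mapsto> f (x v\<^sup>T)\<close>, the theorem is a change of variables in the
  integral defining \<open>\<Psi>'\<close>.  Write \<open>v = V\<^sub>0 + V\<^sub>1 t + \<dots>\<close> with \<open>V\<^sub>0\<close> lower triangular unipotent.  For
  \<open>x = X\<^sub>-\<^sub>1 t\<^sup>-\<^sup>1 + X\<^sub>-\<^sub>2 t\<^sup>-\<^sup>2\<close> the polar part of \<open>x v\<^sup>T\<close> is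
  \<open>(X\<^sub>-\<^sub>1 V\<^sub>0\<^sup>T + X\<^sub>-\<^sub>2 V\<^sub>1\<^sup>T) t\<^sup>-\<^sup>1 + X\<^sub>-\<^sub>2 V\<^sub>0\<^sup>T t\<^sup>-\<^sup>2\<close>.
  Right multiplication by the upper triangular unipotent \<open>V\<^sub>0\<^sup>T\<close> preserves Hessenberg matrices and adds
  to each column a combination of earlier ones; it fixes \<open>X\<^sub>-\<^sub>2\<close>, which is supported in its last column;
  and \<open>X\<^sub>-\<^sub>2 V\<^sub>1\<^sup>T\<close> only changes the first row.  So the polar part is again a point of the domain of
  integration, with coordinates \<open>T x\<close> for a unipotent triangular linear map \<open>T\<close>
  (\<open>polar_part_hess_point_mult\<close>).

  Such a \<open>T\<close> is a composition of shears of one variable each, so Fubini and translation invariance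
  show that it preserves Lebesgue measure (\<open>distr_triangular_shift\<close>).  The subdiagonal entries and
  the entry of \<open>X\<^sub>-\<^sub>2\<close>, which are the denominators of the phase, are fixed by \<open>T\<close>, and each numerator
  gains a multiple of its denominator, so off the null set where a denominator vanishes the phase
  gains the constant \<open>d\<^sub>1 v\<^sub>1 + \<dots> + d\<^sub>n z\<^sub>n\<close> (\<open>whittaker_phase_shift\<close>).  Substituting \<open>T\<close> in
  \<open>\<Psi>' f\<close> then produces exactly the factor \<open>\<chi>\<close>.

  The phase factor has modulus one, so convergence only requires the rapid decay of \<open>f\<close> along the
  coordinates of the domain of integration (\<open>integrable_Psi_integrand\<close>).
\<close>

section \<open>Unipotent triangular substitutions preserve Lebesgue measure\<close>

text \<open>
  Integrate over the \<open>m\<close>-th variable first: for fixed values of the others the map is a translation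
  of the line.
\<close>

lemma distr_shear:
  fixes \<phi> :: "('i \<Rightarrow> real) \<Rightarrow> real"
  assumes "finite I" "m \<in> I"
    and [measurable]: "\<phi> \<in> borel_measurable (PiM I (\<lambda>_. lborel))"
    and indep: "\<And>x y. \<phi> (x(m := y)) = \<phi> x"
  shows "distr (PiM I (\<lambda>_. lborel)) (PiM I (\<lambda>_. lborel)) (\<lambda>x. x(m := x m + \<phi> x)) = PiM I (\<lambda>_. lborel)"
    (is "distr ?M ?M ?S = ?M")
proof (rule measure_eqI)
  interpret product_sigma_finite "\<lambda>_::'i. lborel :: real measure"
    by (simp add: product_sigma_finite_def sigma_finite_lborel)
  define J where "J = I - {m}"
  have I: "I = insert m J" and J: "finite J" "m \<notin> J"
    using assms(1,2) by (auto simp: J_def)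
  have S[measurable]: "?S \<in> measurable ?M ?M"
    using assms(2) by (intro measurable_fun_upd[where J = I]) auto
  fix A assume "A \<in> sets (distr ?M ?M ?S)"
  then have A[measurable]: "A \<in> sets ?M" by simp
  have indA: "(\<lambda>x. indicator A x :: ennreal) \<in> borel_measurable ?M"
    by measurable
  have "emeasure (distr ?M ?M ?S) A = (\<integral>\<^sup>+x. indicator A x \<partial>distr ?M ?M ?S)"
    by simp
  also have "\<dots> = (\<integral>\<^sup>+x. indicator A (?S x) \<partial>?M)"
    by (intro nn_integral_distr S) (simp add: indA)
  also have "\<dots> = (\<integral>\<^sup>+x. \<integral>\<^sup>+y. indicator A (?S (x(m := y))) \<partial>lborel \<partial>PiM J (\<lambda>_. lborel))"
    unfolding I by (rule product_nn_integral_insert[OF J]) (simp add: I[symmetric])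
  also have "\<dots> = (\<integral>\<^sup>+x. \<integral>\<^sup>+y. indicator A (x(m := \<phi> x + y)) \<partial>lborel \<partial>PiM J (\<lambda>_. lborel))"
    by (simp add: indep add.commute)
  also have "\<dots> = (\<integral>\<^sup>+x. \<integral>\<^sup>+y. indicator A (x(m := y)) \<partial>lborel \<partial>PiM J (\<lambda>_. lborel))"
  proof (rule nn_integral_cong)
    fix x :: "'i \<Rightarrow> real" assume x: "x \<in> space (PiM J (\<lambda>_. lborel))"
    have "(\<lambda>y. x(m := y)) \<in> measurable borel ?M"
      using x J by (intro measurable_fun_upd[where J = J]) (auto simp: I)
    then have [measurable]: "(\<lambda>y. indicator A (x(m := y)) :: ennreal) \<in> borel_measurable borel"
      by measurable
    show "(\<integral>\<^sup>+y. indicator A (x(m := \<phi> x + y)) \<partial>lborel) = (\<integral>\<^sup>+y. indicator A (x(m := y)) \<partial>lborel)"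
      using nn_integral_real_affine[of "\<lambda>y. indicator A (x(m := y))" 1 "\<phi> x"] by simp
  qed
  also have "\<dots> = (\<integral>\<^sup>+x. indicator A x \<partial>?M)"
    unfolding I by (rule product_nn_integral_insert[OF J, symmetric]) (simp add: I[symmetric])
  also have "\<dots> = emeasure ?M A" by simp
  finally show "emeasure (distr ?M ?M ?S) A = emeasure ?M A" .
qed simp

text \<open>
  The set \<open>S\<close> of modified coordinates is a parameter because the measure preservation is proved by
  enlarging \<open>S\<close> one coordinate at a time.
\<close>

definition triangular_shift :: "'i set \<Rightarrow> ('i \<Rightarrow> ('i \<Rightarrow> real) \<Rightarrow> real) \<Rightarrow> ('i \<Rightarrow> real) \<Rightarrow> 'i \<Rightarrow> real" where
  "triangular_shift S \<phi> x = (\<lambda>i. if i \<in> S then x i + \<phi> i x else x i)"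

text \<open>
  Triangularity is expressed by a rank, which need not be injective: \<open>\<phi> i\<close> sees only coordinates of
  strictly smaller rank.  Adding the coordinates in order of increasing rank, the shear of the newest
  coordinate can be performed first, because none of the other shifts depends on that coordinate.
\<close>

lemma distr_triangular_shift:
  fixes rank :: "'i \<Rightarrow> nat" and \<phi> :: "'i \<Rightarrow> ('i \<Rightarrow> real) \<Rightarrow> real"
  assumes "finite I" "S \<subseteq> I"
    and meas: "\<And>i. i \<in> I \<Longrightarrow> \<phi> i \<in> borel_measurable (PiM I (\<lambda>_. lborel))"
    and dep: "\<And>i x y. i \<in> I \<Longrightarrow> (\<And>j. rank j < rank i \<Longrightarrow> x j = y j) \<Longrightarrow> \<phi> i x = \<phi> i y"
  shows "triangular_shift S \<phi> \<in> measurable (PiM I (\<lambda>_. lborel)) (PiM I (\<lambda>_. lborel))"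
    and "distr (PiM I (\<lambda>_. lborel)) (PiM I (\<lambda>_. lborel)) (triangular_shift S \<phi>) = PiM I (\<lambda>_. lborel)"
proof -
  let ?M = "PiM I (\<lambda>_::'i. lborel :: real measure)"
  have "finite S" using assms(1,2) finite_subset by blast
  then have "S \<subseteq> I \<longrightarrow> triangular_shift S \<phi> \<in> measurable ?M ?M \<and> distr ?M ?M (triangular_shift S \<phi>) = ?M"
  proof (induction S rule: finite_ranking_induct[where f = rank])
    case empty
    have "triangular_shift {} \<phi> = (\<lambda>x. x)" by (simp add: triangular_shift_def fun_eq_iff)
    then show ?case by simp
  next
    case (insert m S)
    show ?case
    proof (intro impI)
      assume sub: "insert m S \<subseteq> I"
      show "triangular_shift (insert m S) \<phi> \<in> measurable ?M ?M \<and>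
          distr ?M ?M (triangular_shift (insert m S) \<phi>) = ?M"
      proof (cases "m \<in> S")
        case True
        then show ?thesis using insert sub by (simp add: insert_absorb)
      next
        case False
        let ?S = "\<lambda>x. x(m := x m + \<phi> m x)"
        have m: "m \<in> I" using sub by simp
        have [measurable]: "\<phi> m \<in> borel_measurable ?M" using m by (rule meas)
        have S: "?S \<in> measurable ?M ?M"
          using m by (intro measurable_fun_upd[where J = I]) auto
        have T: "triangular_shift S \<phi> \<in> measurable ?M ?M" "distr ?M ?M (triangular_shift S \<phi>) = ?M"
          using insert sub by auto
        have dS: "distr ?M ?M ?S = ?M"
          using assms(1) m by (intro distr_shear) (auto intro!: dep)
        have eq: "triangular_shift (insert m S) \<phi> = triangular_shift S \<phi> \<circ> ?S"
        proof (intro ext)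
          fix x i
          have "\<phi> i (?S x) = \<phi> i x" if "i \<in> S"
            using that insert(2)[OF that] sub by (intro dep) auto
          then show "triangular_shift (insert m S) \<phi> x i = (triangular_shift S \<phi> \<circ> ?S) x i"
            using False by (auto simp: triangular_shift_def)
        qed
        show ?thesis
          unfolding eq using measurable_comp[OF S T(1)] distr_distr[OF T(1) S] dS T(2) by simp
      qed
    qed
  qed
  then show "triangular_shift S \<phi> \<in> measurable ?M ?M" "distr ?M ?M (triangular_shift S \<phi>) = ?M"
    using assms(2) by auto
qed

lemma AE_PiM_lborel_neq:
  fixes a :: real
  assumes "finite I" "i \<in> I"
  shows "AE x in PiM I (\<lambda>_. lborel). x i \<noteq> a"
proof -
  interpret product_sigma_finite "\<lambda>_::'a. lborel :: real measure"
    by (simp add: product_sigma_finite_def sigma_finite_lborel)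
  let ?N = "PiE I (\<lambda>j. if j = i then {a} else UNIV)"
  have "emeasure (PiM I (\<lambda>_. lborel)) ?N = (\<Prod>j\<in>I. emeasure lborel (if j = i then {a} else UNIV))"
    using assms(1) by (intro emeasure_PiM) auto
  also have "\<dots> = 0"
    using assms by (intro prod_zero) auto
  finally have "?N \<in> null_sets (PiM I (\<lambda>_. lborel))"
    using assms(1) by (intro null_setsI sets_PiM_I_finite) auto
  then show ?thesis
    by (rule AE_I') (auto simp: space_PiM PiE_def Pi_def)
qed

section \<open>Rapid decay and integrability\<close>

lemma integrable_PiM_rapid_decay:
  assumes "finite I"
  shows "integrable (PiM I (\<lambda>_. lborel)) (\<lambda>x. \<Prod>i\<in>I. inverse (1 + (x i)\<^sup>2) :: real)"
proof -
  interpret product_sigma_finite "\<lambda>_::'a. lborel :: real measure"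
    by (simp add: product_sigma_finite_def sigma_finite_lborel)
  have "integrable lborel (\<lambda>x::real. inverse (1 + x\<^sup>2))"
    using integrable_inverse_1_plus_square by (simp add: set_integrable_def)
  then show ?thesis
    using assms by (intro product_integrable_prod) auto
qed

text \<open>
  The seminorms without derivatives bound all monomials times \<open>g\<close>, hence also the product of the
  \<open>1 + (c i)\<^sup>2\<close>, which is expanded one factor at a time.  This is why the induction carries an
  arbitrary extra monomial.
\<close>

lemma schwartz_coords_decay:
  assumes "schwartz_coords k g"
  shows "\<exists>C. \<forall>c. norm (g c) \<le> C * (\<Prod>i<k. inverse (1 + (c i)\<^sup>2))"
proof -
  have base: "bounded (range (\<lambda>c. complex_of_real (\<Prod>i<k. c i ^ m i) * g c))" for m
    using assms unfolding schwartz_coords_def iter_partial_def by (auto dest: bspec[where x = "[]"])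
  have "bounded (range (\<lambda>c. complex_of_real ((\<Prod>i<l. 1 + (c i)\<^sup>2) * (\<Prod>i<k. c i ^ m i)) * g c))"
    if "l \<le> k" for l m
    using that
  proof (induction l arbitrary: m)
    case 0
    then show ?case using base by simp
  next
    case (Suc l)
    let ?h = "\<lambda>m c. complex_of_real ((\<Prod>i<l. 1 + (c i)\<^sup>2) * (\<Prod>i<k. c i ^ m i)) * g c"
    have "(\<Prod>i<k. c i ^ (m(l := m l + 2)) i) = (c l)\<^sup>2 * (\<Prod>i<k. c i ^ m i)" for c :: "nat \<Rightarrow> real"
    proof -
      have "(\<Prod>i<k. c i ^ (m(l := m l + 2)) i) = (\<Prod>i<k. (if i = l then (c l)\<^sup>2 else 1) * c i ^ m i)"
        by (rule prod.cong) (auto simp: power_add power2_eq_square)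
      also have "\<dots> = (c l)\<^sup>2 * (\<Prod>i<k. c i ^ m i)"
        using Suc.prems by (simp add: prod.distrib)
      finally show ?thesis .
    qed
    then have eq: "(\<lambda>c. complex_of_real ((\<Prod>i<Suc l. 1 + (c i)\<^sup>2) * (\<Prod>i<k. c i ^ m i)) * g c)
        = (\<lambda>c. ?h m c + ?h (m(l := m l + 2)) c)"
      by (simp add: algebra_simps fun_eq_iff)
    show ?case
      unfolding eq using Suc.prems by (intro bounded_plus_comp Suc.IH) simp_all
  qed
  from this[of k "\<lambda>_. 0"]
  obtain C where C: "norm (complex_of_real (\<Prod>i<k. 1 + (c i)\<^sup>2) * g c) \<le> C" for c
    by (auto simp: bounded_iff)
  have "norm (g c) \<le> C * (\<Prod>i<k. inverse (1 + (c i)\<^sup>2))" for c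
  proof -
    have pos: "(\<Prod>i<k. 1 + (c i)\<^sup>2) > 0"
      by (intro prod_pos) (auto intro: add_pos_nonneg)
    have "(\<Prod>i<k. 1 + (c i)\<^sup>2) * norm (g c) \<le> C"
      using C[of c] pos unfolding norm_mult norm_of_real by simp
    moreover have "(\<Prod>i<k. inverse (1 + (c i)\<^sup>2)) = inverse (\<Prod>i<k. 1 + (c i)\<^sup>2)"
      using prod_inversef[of "\<lambda>i. 1 + (c i)\<^sup>2" "{..<k}"] by (simp add: o_def)
    ultimately show ?thesis
      using pos by (simp only:) (simp add: field_simps)
  qed
  then show ?thesis by blast
qed

section \<open>Coordinates on the domain of integration\<close>

lemma hess_point_carrier [simp]: "hess_point n x \<in> carrier_mat n n"
  by (simp add: hess_point_def polar_monom_def)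

lemma hess_point_dim [simp]: "dim_row (hess_point n x) = n" "dim_col (hess_point n x) = n"
  by (simp_all add: hess_point_def polar_monom_def)

text \<open>
  The factor \<open>a\<close> covers both uses: \<open>a = 1\<close> gives the coefficients of the matrix itself, and a power
  series gives the terms of the matrix product with \<open>v\<^sup>T\<close>.
\<close>

lemma nth_hess_point_mult:
  assumes "p < n" "q < n"
  shows "fls_nth (hess_point n x $$ (p, q) * a) j =
    (if p \<le> q + 1 then x (1, p, q) else 0) * fls_nth a (j + 1) +
    (if p = 0 \<and> q = n - 1 then x (2, p, q) else 0) * fls_nth a (j + 2)"
proof -
  have monom: "fls_nth (fls_X_inv ^ k * fls_const c * a) j = c * fls_nth a (j + int k)" for k c
    by (subst mult.assoc) (simp add: fls_X_inv_power_times_conv_shift(1))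
  have "hess_point n x $$ (p, q) = fls_X_inv ^ 1 * fls_const (if p \<le> q + 1 then x (1, p, q) else 0)
      + fls_X_inv ^ 2 * fls_const (if p = 0 \<and> q = n - 1 then x (2, p, q) else 0)"
    using assms by (simp add: hess_point_def polar_monom_def)
  then show ?thesis
    by (simp only: distrib_right fls_plus_nth monom) simp
qed

lemma nth_hess_point:
  assumes "p < n" "q < n"
  shows "fls_nth (hess_point n x $$ (p, q)) j =
    (if j = -1 \<and> p \<le> q + 1 then x (1, p, q)
     else if j = -2 \<and> p = 0 \<and> q = n - 1 then x (2, p, q) else 0)"
  using nth_hess_point_mult[OF assms, of x 1 j] by auto

lemma nth_polar_part: "fls_nth (polar_part a) j = (if j < 0 then fls_nth a j else 0)"
  by (simp add: polar_part_def)

lemma hess_point_cong: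
  assumes "n \<ge> 2" "\<And>i. i \<in> hess_vars n \<Longrightarrow> x i = y i"
  shows "hess_point n x = hess_point n y"
proof (rule eq_matI; simp)
  fix p q assume "p < n" "q < n"
  then show "hess_point n x $$ (p, q) = hess_point n y $$ (p, q)"
    using assms by (intro fls_eqI) (auto simp: nth_hess_point hess_vars_def)
qed

lemma hess_point_polar: "hess_point n x \<in> polar_matrices n"
  by (auto simp: polar_matrices_def nth_hess_point intro!: fps_ext)

lemma lincomb_hess_point:
  "lincomb_mat n k (\<lambda>i. hess_point n (b i)) c = hess_point n (\<lambda>v. \<Sum>i<k. c i * b i v)"
  by (rule eq_matI) (auto simp: lincomb_mat_def fls_eq_iff fls_nth_sum nth_hess_point)

section \<open>The action of \<open>v\<close> in coordinates\<close>

text \<open>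
  The increments of the entries of \<open>X\<^sub>-\<^sub>1\<close> in \<open>X\<^sub>-\<^sub>1 V\<^sub>0\<^sup>T + X\<^sub>-\<^sub>2 V\<^sub>1\<^sup>T\<close>.  The range of \<open>r\<close> keeps the
  entries of \<open>X\<^sub>-\<^sub>1\<close> left of column \<open>q\<close> that lie in the Hessenberg region.
\<close>

definition hess_shift ::
  "nat \<Rightarrow> real fps mat \<Rightarrow> nat \<times> nat \<times> nat \<Rightarrow> (nat \<times> nat \<times> nat \<Rightarrow> real) \<Rightarrow> real" where
  "hess_shift n v = (\<lambda>(i, p, q) x.
     if i = 1 then
       (\<Sum>r | r < q \<and> p \<le> r + 1. x (1, p, r) * coeff_mat 0 v $$ (q, r)) +
       (if p = 0 then x (2, 0, n - 1) * coeff_mat 1 v $$ (q, n - 1) else 0)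
     else 0)"

text \<open>
  Comparing coefficients of the \<open>(p,q)\<close>-entries: at \<open>t\<^sup>-\<^sup>1\<close> the unit diagonal of \<open>V\<^sub>0\<close> gives back
  \<open>x (1, p, q)\<close> and the terms \<open>r < q\<close> and the entry of \<open>X\<^sub>-\<^sub>2\<close> give the increment; at \<open>t\<^sup>-\<^sup>2\<close> only the
  last row of \<open>V\<^sub>0\<^sup>T\<close> enters, which is \<open>(0, \<dots>, 0, 1)\<close>; lower powers do not occur.
\<close>

lemma polar_part_hess_point_mult:
  assumes n: "n \<ge> 2" and v: "v \<in> carrier_mat n n" and low: "lower_unipotent (coeff_mat 0 v)"
  shows "map_mat polar_part (hess_point n x * transpose_mat (map_mat fps_to_fls v)) =
    hess_point n (triangular_shift (hess_vars n) (hess_shift n v) x)"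
proof (rule eq_matI)
  let ?y = "triangular_shift (hess_vars n) (hess_shift n v) x"
  fix p q assume "p < dim_row (hess_point n ?y)" "q < dim_col (hess_point n ?y)"
  then have p: "p < n" and q: "q < n" by simp_all
  define V where "V k r = coeff_mat k v $$ (q, r)" for k r
  have Vnth: "fls_nth (fps_to_fls (v $$ (q, r))) (int k) = V k r" if "r < n" for k r
    using that v q by (simp add: V_def coeff_mat_def)
  have V0: "V 0 r = 0" if "q < r" "r < n" for r
    using low v that unfolding lower_unipotent_def V_def by (simp add: coeff_mat_def)
  have V1: "V 0 q = 1"
    using low v q unfolding lower_unipotent_def V_def by (simp add: coeff_mat_def)
  define c1 where "c1 r = (if p \<le> r + 1 then x (1, p, r) else 0)" for r
  define c2 where "c2 r = (if p = 0 \<and> r = n - 1 then x (2, p, r) else 0)" for r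
  let ?P = "(hess_point n x * transpose_mat (map_mat fps_to_fls v)) $$ (p, q)"
  have "?P = (\<Sum>r<n. hess_point n x $$ (p, r) * fps_to_fls (v $$ (q, r)))"
    using p q v by (simp add: times_mat_def scalar_prod_def lessThan_atLeast0)
  then have P: "fls_nth ?P j = (\<Sum>r<n. c1 r * fls_nth (fps_to_fls (v $$ (q, r))) (j + 1)
      + c2 r * fls_nth (fps_to_fls (v $$ (q, r))) (j + 2))" for j
    using p by (simp add: fls_nth_sum nth_hess_point_mult c1_def c2_def del: fps_to_fls_nth)
  have c2_sum: "(\<Sum>r<n. c2 r * w r) = (if p = 0 then x (2, 0, n - 1) * w (n - 1) else 0)" for w
  proof -
    have "(\<Sum>r<n. c2 r * w r) = (\<Sum>r<n. if r = n - 1 then (if p = 0 then x (2, 0, n - 1) * w (n - 1) else 0) else 0)"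
      by (rule sum.cong) (auto simp: c2_def)
    then show ?thesis using n by simp
  qed
  have c1_sum: "(\<Sum>r<n. c1 r * V 0 r) =
    (if p \<le> q + 1 then x (1, p, q) + (\<Sum>r | r < q \<and> p \<le> r + 1. x (1, p, r) * V 0 r) else 0)"
  proof -
    have "(\<Sum>r<n. c1 r * V 0 r) = (\<Sum>r\<in>insert q {..<q}. c1 r * V 0 r)"
      using q V0 by (intro sum.mono_neutral_right) (auto simp: not_less)
    also have "\<dots> = c1 q + (\<Sum>r<q. c1 r * V 0 r)"
      by (simp add: V1)
    also have "(\<Sum>r<q. c1 r * V 0 r) = (\<Sum>r | r < q \<and> p \<le> r + 1. x (1, p, r) * V 0 r)"
      by (rule sum.mono_neutral_cong_right) (auto simp: c1_def)
    also have "\<dots> = (if p \<le> q + 1 then (\<Sum>r | r < q \<and> p \<le> r + 1. x (1, p, r) * V 0 r) else 0)"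
      by (auto intro!: sum.neutral)
    finally show ?thesis by (simp add: c1_def)
  qed
  have "fls_nth (polar_part ?P) j = fls_nth (hess_point n ?y $$ (p, q)) j" for j
  proof -
    consider "j = -1" | "j = -2" | "j \<ge> 0" | "j < -2" by linarith
    then show ?thesis
    proof cases
      case 1
      have "fls_nth ?P j = (\<Sum>r<n. c1 r * V 0 r + c2 r * V 1 r)"
        using Vnth[of _ 0] Vnth[of _ 1] unfolding P by (intro sum.cong) (auto simp: 1)
      also have "\<dots> = fls_nth (hess_point n ?y $$ (p, q)) j"
        using p q 1 by (auto simp: sum.distrib c1_sum[unfolded V_def] c2_sum nth_hess_point
            triangular_shift_def hess_shift_def hess_vars_def V_def)
      finally show ?thesis by (simp add: 1 nth_polar_part)
    next
      case 2
      have "fls_nth ?P j = (\<Sum>r<n. c2 r * V 0 r)"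
        using Vnth[of _ 0] unfolding P by (intro sum.cong) (auto simp: 2)
      also have "\<dots> = fls_nth (hess_point n ?y $$ (p, q)) j"
        using p q 2 V0[of "n - 1"] V1
        by (cases "q = n - 1") (auto simp: c2_sum nth_hess_point triangular_shift_def hess_shift_def hess_vars_def)
      finally show ?thesis by (simp add: 2 nth_polar_part)
    next
      case 3
      then show ?thesis using p q by (simp add: nth_polar_part nth_hess_point)
    next
      case 4
      then have "fls_nth ?P j = 0" unfolding P by simp
      then show ?thesis using p q 4 by (simp add: nth_polar_part nth_hess_point)
    qed
  qed
  then have "polar_part ?P = hess_point n ?y $$ (p, q)" by (intro fls_eqI)
  then show "map_mat polar_part (hess_point n x * transpose_mat (map_mat fps_to_fls v)) $$ (p, q) =
      hess_point n ?y $$ (p, q)"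
    using p q v by simp
qed (use v in simp_all)

lemma inverse_mat_unique:
  assumes "v \<in> carrier_mat n n" "w \<in> carrier_mat n n" "inverts_mat v w" "inverts_mat w v"
  shows "inverse_mat n v = w"
  unfolding inverse_mat_def
proof (rule the_equality)
  fix u assume u: "u \<in> carrier_mat n n \<and> inverts_mat v u \<and> inverts_mat u v"
  have "u = (w * v) * u"
    using assms u by (auto simp: inverts_mat_def)
  also have "\<dots> = w * (v * u)"
    using assms u by (intro assoc_mult_mat) auto
  also have "\<dots> = w"
    using assms u by (auto simp: inverts_mat_def)
  finally show "u = w" .
qed (use assms in simp)

text \<open>
  Power series do not form a field, but determinant one makes the adjugate an inverse.
\<close>

lemma inverse_mat_inverse_mat:
  assumes "v \<in> SL_fps n"
  shows "inverse_mat n (inverse_mat n v) = v"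
proof -
  have v: "v \<in> carrier_mat n n" "det v = 1" using assms by (auto simp: SL_fps_def)
  note adj = adj_mat[OF v(1)]
  have "1 \<cdot>\<^sub>m 1\<^sub>m n = (1\<^sub>m n :: real fps mat)" by (rule eq_matI) auto
  then have inv: "inverts_mat v (adj_mat v)" "inverts_mat (adj_mat v) v"
    using adj v by (auto simp: inverts_mat_def)
  show ?thesis
    using inverse_mat_unique[OF v(1) adj(1) inv] inverse_mat_unique[OF adj(1) v(1) inv(2,1)] by simp
qed

section \<open>Schwartz functions on the domain of integration\<close>

lemma finite_hess_vars: "finite (hess_vars n)"
proof -
  have "hess_vars n \<subseteq> {1} \<times> {..<n} \<times> {..<n} \<union> {(2, 0, n - 1)}" by (auto simp: hess_vars_def)
  then show ?thesis by (rule finite_subset) simp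
qed

text \<open>
  The points \<open>hess_point n x\<close> form a finite-dimensional space of polar matrices with the elementary
  matrices \<open>E\<^sub>p\<^sub>q t\<^sup>-\<^sup>i\<close> as a basis.  An enumeration \<open>h\<close> of the variables orders that basis, so that
  the Schwartz condition can be applied to it.
\<close>

lemma schwartz_hess_point:
  assumes n: "n \<ge> 2" and f: "f \<in> schwartz_space n"
  obtains h k g where "bij_betw h {..<k} (hess_vars n)" "schwartz_coords k g"
    "\<forall>x. f (hess_point n x) = g (\<lambda>i. if i < k then x (h i) else 0)"
proof -
  define k where "k = card (hess_vars n)"
  obtain h where h: "bij_betw h {..<k} (hess_vars n)"
    using ex_bij_betw_nat_finite[OF finite_hess_vars] by (auto simp: k_def lessThan_atLeast0)
  define b where "b i v = (if v = h i then 1 else 0 :: real)" for i v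
  have val: "(\<Sum>j<k. c j * b j (h i)) = c i" if "i < k" for c i
  proof -
    have "(\<Sum>j<k. c j * b j (h i)) = (\<Sum>j<k. if j = i then c i else 0)"
      using h that by (intro sum.cong) (auto simp: b_def bij_betw_def inj_on_def)
    then show ?thesis using that by simp
  qed
  have indep: "real_independent n k (\<lambda>i. hess_point n (b i))"
    unfolding real_independent_def lincomb_hess_point
  proof (intro allI impI)
    fix c i assume z: "hess_point n (\<lambda>v. \<Sum>i<k. c i * b i v) = 0\<^sub>m n n" and i: "i < k"
    obtain l p q where lpq: "h i = (l, p, q)" by (metis prod_cases3)
    have "h i \<in> hess_vars n" using h i by (auto simp: bij_betw_def)
    then have "p < n" "q < n" and l: "l = 1 \<and> p \<le> q + 1 \<or> l = 2 \<and> p = 0 \<and> q = n - 1"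
      using n lpq by (auto simp: hess_vars_def)
    define w where "w = (\<lambda>v. \<Sum>i<k. c i * b i v)"
    have "fls_nth (hess_point n w $$ (p, q)) (- int l) = w (l, p, q)"
      using l nth_hess_point[OF \<open>p < n\<close> \<open>q < n\<close>] by auto
    also have "\<dots> = c i"
      using val[OF i, of c] by (simp add: w_def lpq)
    finally show "c i = 0"
      using z \<open>p < n\<close> \<open>q < n\<close> by (simp add: w_def)
  qed
  define g where "g c = f (lincomb_mat n k (\<lambda>i. hess_point n (b i)) c)" for c
  have "(\<forall>i<k. hess_point n (b i) \<in> polar_matrices n) \<and> real_independent n k (\<lambda>i. hess_point n (b i))"
    using indep by (simp add: hess_point_polar)
  then have "schwartz_coords k g"
    using f[unfolded schwartz_space_def mem_Collect_eq, rule_format, of k "\<lambda>i. hess_point n (b i)"]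
    unfolding g_def by blast
  moreover have "f (hess_point n x) = g (\<lambda>i. if i < k then x (h i) else 0)" for x
  proof -
    have "hess_point n x = hess_point n (\<lambda>v. \<Sum>i<k. (if i < k then x (h i) else 0) * b i v)"
    proof (rule hess_point_cong[OF n])
      fix w assume "w \<in> hess_vars n"
      then obtain i where "i < k" "w = h i" using h by (auto simp: bij_betw_def)
      then show "x w = (\<Sum>i<k. (if i < k then x (h i) else 0) * b i w)"
        using val[of i "\<lambda>i. if i < k then x (h i) else 0"] by simp
    qed
    then show ?thesis by (simp add: g_def lincomb_hess_point)
  qed
  ultimately show ?thesis using that h by blast
qed


section \<open>Convergence of the integral\<close>

lemma measurable_hess_coord:
  assumes "i \<in> hess_vars n"
  shows "(\<lambda>x. x i :: real) \<in> borel_measurable (PiM (hess_vars n) (\<lambda>_. lborel))"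
  using measurable_component_singleton[OF assms, of "\<lambda>_. lborel :: real measure"] by simp

lemma borel_measurable_whittaker_phase:
  assumes "n \<ge> 2"
  shows "whittaker_phase n d \<in> borel_measurable (PiM (hess_vars n) (\<lambda>_. lborel))"
  unfolding whittaker_phase_def using assms
  by (intro borel_measurable_add borel_measurable_sum borel_measurable_times borel_measurable_divide
      borel_measurable_const measurable_hess_coord) (auto simp: hess_vars_def)

text \<open>
  Schwartz functions are continuous for the product topology on \<open>nat \<Rightarrow> real\<close>, whose Borel sets are
  those of the countable product of Borel \<open>\<sigma>\<close>-algebras; this is what makes \<open>f\<close> measurable
  in the integration variables.
\<close>

lemma schwartz_hess_point_bound:
  assumes "n \<ge> 2" "f \<in> schwartz_space n"
  shows "(\<lambda>x. f (hess_point n x)) \<in> borel_measurable (PiM (hess_vars n) (\<lambda>_. lborel))"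
    and "\<exists>C. \<forall>x. norm (f (hess_point n x)) \<le> C * (\<Prod>i\<in>hess_vars n. inverse (1 + (x i)\<^sup>2))"
proof -
  obtain h k g where h: "bij_betw h {..<k} (hess_vars n)" and g: "schwartz_coords k g"
    and eq: "\<forall>x. f (hess_point n x) = g (\<lambda>i. if i < k then x (h i) else 0)"
    by (rule schwartz_hess_point[OF assms])
  note eq = eq[rule_format]
  have "continuous_on UNIV g"
    using g unfolding schwartz_coords_def smooth_coords_def iter_partial_def
    by (auto dest: bspec[where x = "[]"])
  then have "g \<in> borel_measurable borel"
    by (rule borel_measurable_continuous_onI)
  moreover have "(\<lambda>x i. if i < k then x (h i) else 0) \<in> measurable (PiM (hess_vars n) (\<lambda>_. lborel)) (PiM UNIV (\<lambda>_. borel))"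
  proof (rule measurable_PiM_single')
    fix i :: nat
    show "(\<lambda>x. if i < k then x (h i) else 0) \<in> borel_measurable (PiM (hess_vars n) (\<lambda>_. lborel))"
      using bij_betwE[OF h] measurable_hess_coord[of "h i" n] by (cases "i < k") simp_all
  qed (auto simp: PiE_def extensional_def)
  then have "(\<lambda>x i. if i < k then x (h i) else 0) \<in> measurable (PiM (hess_vars n) (\<lambda>_. lborel)) borel"
    using measurable_cong_sets[OF refl sets_PiM_equal_borel] by blast
  ultimately show "(\<lambda>x. f (hess_point n x)) \<in> borel_measurable (PiM (hess_vars n) (\<lambda>_. lborel))"
    unfolding eq by (rule measurable_compose[rotated])
  obtain C where C: "\<And>c. norm (g c) \<le> C * (\<Prod>i<k. inverse (1 + (c i)\<^sup>2))"
    using schwartz_coords_decay[OF g] by blast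
  have "norm (f (hess_point n x)) \<le> C * (\<Prod>i\<in>hess_vars n. inverse (1 + (x i)\<^sup>2))" for x
    using C[of "\<lambda>i. if i < k then x (h i) else 0"]
      prod.reindex_bij_betw[OF h, of "\<lambda>i. inverse (1 + (x i)\<^sup>2)"]
    unfolding eq by simp
  then show "\<exists>C. \<forall>x. norm (f (hess_point n x)) \<le> C * (\<Prod>i\<in>hess_vars n. inverse (1 + (x i)\<^sup>2))"
    by blast
qed

lemma borel_measurable_phase_mult:
  assumes "n \<ge> 2" "F \<in> borel_measurable (PiM (hess_vars n) (\<lambda>_. lborel))"
  shows "(\<lambda>x. F x * exp (2 * complex_of_real pi * \<i> * complex_of_real (whittaker_phase n d x)))
    \<in> borel_measurable (PiM (hess_vars n) (\<lambda>_. lborel))"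
proof -
  note [measurable] = assms(2) borel_measurable_whittaker_phase[OF assms(1)]
  show ?thesis by measurable
qed

lemma integrable_Psi_integrand:
  assumes "n \<ge> 2" "f \<in> schwartz_space n"
  shows "integrable (PiM (hess_vars n) (\<lambda>_. lborel)) (Psi_integrand n d f)"
proof -
  obtain C where C: "\<And>x. norm (f (hess_point n x)) \<le> C * (\<Prod>i\<in>hess_vars n. inverse (1 + (x i)\<^sup>2))"
    using schwartz_hess_point_bound(2)[OF assms] by blast
  show ?thesis
  proof (rule Bochner_Integration.integrable_bound)
    show "integrable (PiM (hess_vars n) (\<lambda>_. lborel)) (\<lambda>x. C * (\<Prod>i\<in>hess_vars n. inverse (1 + (x i)\<^sup>2)))"
      by (intro integrable_mult_right integrable_PiM_rapid_decay finite_hess_vars)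
    show "Psi_integrand n d f \<in> borel_measurable (PiM (hess_vars n) (\<lambda>_. lborel))"
      unfolding Psi_integrand_def
      by (intro borel_measurable_phase_mult schwartz_hess_point_bound assms)
    have "norm (Psi_integrand n d f x) \<le> norm (C * (\<Prod>i\<in>hess_vars n. inverse (1 + (x i)\<^sup>2)))" for x
    proof -
      have "norm (exp (2 * complex_of_real pi * \<i> * complex_of_real (whittaker_phase n d x))) = 1"
        using norm_exp_i_times[of "2 * pi * whittaker_phase n d x"] by (simp add: mult_ac)
      then have "norm (Psi_integrand n d f x) = norm (f (hess_point n x))"
        by (simp add: Psi_integrand_def norm_mult)
      also have "\<dots> \<le> C * (\<Prod>i\<in>hess_vars n. inverse (1 + (x i)\<^sup>2))" by (rule C)
      finally show ?thesis by simp
    qed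
    then show "AE x in PiM (hess_vars n) (\<lambda>_. lborel). norm (Psi_integrand n d f x)
        \<le> norm (C * (\<Prod>i\<in>hess_vars n. inverse (1 + (x i)\<^sup>2)))"
      by simp
  qed
qed

section \<open>Equivariance\<close>

text \<open>
  The increment of an entry of \<open>X\<^sub>-\<^sub>1\<close> involves the entry of \<open>X\<^sub>-\<^sub>2\<close> and entries of \<open>X\<^sub>-\<^sub>1\<close> in earlier
  columns.  So the column number is a rank, with the variable of \<open>X\<^sub>-\<^sub>2\<close> placed before all columns.
\<close>

lemma distr_hess_shift:
  fixes n v
  assumes "n \<ge> 2"
  defines "T \<equiv> triangular_shift (hess_vars n) (hess_shift n v)"
  shows "T \<in> measurable (PiM (hess_vars n) (\<lambda>_. lborel)) (PiM (hess_vars n) (\<lambda>_. lborel))"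
    and "distr (PiM (hess_vars n) (\<lambda>_. lborel)) (PiM (hess_vars n) (\<lambda>_. lborel)) T
      = PiM (hess_vars n) (\<lambda>_. lborel)"
proof -
  define rank :: "nat \<times> nat \<times> nat \<Rightarrow> nat" where
    "rank = (\<lambda>(i, p, q). if i = 1 then q + 1 else 0)"
  have meas: "hess_shift n v i \<in> borel_measurable (PiM (hess_vars n) (\<lambda>_. lborel))"
    if i: "i \<in> hess_vars n" for i
  proof -
    obtain l p q where lpq: "i = (l, p, q)" by (metis prod_cases3)
    show ?thesis
    proof (cases "l = 1")
      case True
      have sum: "(\<lambda>x. \<Sum>r | r < q \<and> p \<le> r + 1. x (1, p, r) * coeff_mat 0 v $$ (q, r))
          \<in> borel_measurable (PiM (hess_vars n) (\<lambda>_. lborel))"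
        using i assms(1) unfolding lpq
        by (intro borel_measurable_sum borel_measurable_times borel_measurable_const measurable_hess_coord)
           (auto simp: hess_vars_def)
      have "(\<lambda>x. x (2, 0, n - 1) * coeff_mat 1 v $$ (q, n - 1))
          \<in> borel_measurable (PiM (hess_vars n) (\<lambda>_. lborel))"
        by (intro borel_measurable_times borel_measurable_const measurable_hess_coord)
           (auto simp: hess_vars_def)
      then show ?thesis
        unfolding lpq hess_shift_def using True sum by (cases "p = 0") auto
    qed (simp add: lpq hess_shift_def)
  qed
  have dep: "hess_shift n v i x = hess_shift n v i y"
    if "\<And>j. rank j < rank i \<Longrightarrow> x j = y j" for i x y
    using that by (auto simp: hess_shift_def rank_def split: prod.splits intro!: sum.cong)
  show "T \<in> measurable (PiM (hess_vars n) (\<lambda>_. lborel)) (PiM (hess_vars n) (\<lambda>_. lborel))"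
    and "distr (PiM (hess_vars n) (\<lambda>_. lborel)) (PiM (hess_vars n) (\<lambda>_. lborel)) T
      = PiM (hess_vars n) (\<lambda>_. lborel)"
    unfolding T_def
    by (rule distr_triangular_shift[where rank = rank]; use finite_hess_vars meas dep in blast)+
qed

definition char_exponent :: "nat \<Rightarrow> real vec \<Rightarrow> real fps mat \<Rightarrow> real" where
  "char_exponent n d v =
     (\<Sum>k<n - 1. d $ k * coeff_mat 0 v $$ (k + 1, k)) + d $ (n - 1) * coeff_mat 1 v $$ (0, n - 1)"

text \<open>
  For the subdiagonal entry \<open>(k + 1, k)\<close> the range of summation in the increment is empty, and for the
  diagonal entry \<open>(k + 1, k + 1)\<close> it is \<open>{k}\<close>, the column of its denominator.  In the corner
  \<open>(0, 0)\<close> the sum is empty and the increment comes from \<open>X\<^sub>-\<^sub>2 V\<^sub>1\<^sup>T\<close>.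
\<close>

lemma whittaker_phase_shift:
  assumes "n \<ge> 2" and nz: "\<And>k. k < n - 1 \<Longrightarrow> x (1, k + 1, k) \<noteq> 0" "x (2, 0, n - 1) \<noteq> 0"
  shows "whittaker_phase n d (triangular_shift (hess_vars n) (hess_shift n v) x)
    = whittaker_phase n d x + char_exponent n d v"
proof -
  let ?T = "triangular_shift (hess_vars n) (hess_shift n v)"
  have sub: "?T x (1, k + 1, k) = x (1, k + 1, k)" if "k < n - 1" for k
    using that by (auto simp: triangular_shift_def hess_shift_def intro!: sum.neutral)
  have diag: "?T x (1, k + 1, k + 1) = x (1, k + 1, k + 1) + x (1, k + 1, k) * coeff_mat 0 v $$ (k + 1, k)"
    if "k < n - 1" for k
  proof -
    have "{r. r < k + 1 \<and> k + 1 \<le> r + 1} = {k}" by auto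
    then show ?thesis
      using that by (auto simp: triangular_shift_def hess_shift_def hess_vars_def)
  qed
  have corner: "?T x (1, 0, 0) = x (1, 0, 0) + x (2, 0, n - 1) * coeff_mat 1 v $$ (0, n - 1)"
    "?T x (2, 0, n - 1) = x (2, 0, n - 1)"
    using assms(1) by (auto simp: triangular_shift_def hess_shift_def hess_vars_def)
  have "(\<Sum>k<n - 1. d $ k * (?T x (1, k + 1, k + 1) / ?T x (1, k + 1, k)))
      = (\<Sum>k<n - 1. d $ k * (x (1, k + 1, k + 1) / x (1, k + 1, k)) + d $ k * coeff_mat 0 v $$ (k + 1, k))"
  proof (rule sum.cong)
    fix k assume "k \<in> {..<n - 1}"
    then have k: "k < n - 1" by simp
    then show "d $ k * (?T x (1, k + 1, k + 1) / ?T x (1, k + 1, k))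
      = d $ k * (x (1, k + 1, k + 1) / x (1, k + 1, k)) + d $ k * coeff_mat 0 v $$ (k + 1, k)"
      unfolding sub[OF k] diag[OF k] using nz(1)[OF k] by (simp add: add_divide_distrib ring_distribs)
  qed simp
  moreover have "d $ (n - 1) * (?T x (1, 0, 0) / ?T x (2, 0, n - 1))
      = d $ (n - 1) * (x (1, 0, 0) / x (2, 0, n - 1)) + d $ (n - 1) * coeff_mat 1 v $$ (0, n - 1)"
    unfolding corner using nz(2) by (simp add: add_divide_distrib ring_distribs)
  ultimately show ?thesis
    unfolding whittaker_phase_def char_exponent_def sum.distrib by linarith
qed

text \<open>
  The integrand of \<open>\<Psi>' (\<pi>\<^sub>2(v)\<^sup>-\<^sup>1 f)\<close> is \<open>f\<close> at \<open>T x\<close> times the phase factor at \<open>x\<close>; rewriting the phase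
  in terms of \<open>T x\<close> costs the constant \<open>\<chi>\<close>, and the substitution \<open>T\<close> does the rest.
\<close>

lemma Psi'_pi2_dual:
  assumes n: "n \<ge> 2" and v: "v \<in> SL_fps n" "lower_unipotent (coeff_mat 0 v)"
    and f: "f \<in> schwartz_space n"
  shows "pi2_dual n v (Psi' n d) f = chi_hat n d v * Psi' n d f"
proof -
  let ?M = "PiM (hess_vars n) (\<lambda>_. lborel :: real measure)"
  let ?T = "triangular_shift (hess_vars n) (hess_shift n v)"
  let ?e = "\<lambda>t. exp (2 * complex_of_real pi * \<i> * complex_of_real t)"
  have carrier: "v \<in> carrier_mat n n" using v by (simp add: SL_fps_def)
  have integrand: "Psi_integrand n d (pi2 n (inverse_mat n v) f)
      = (\<lambda>x. f (hess_point n (?T x)) * ?e (whittaker_phase n d x))"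
    unfolding Psi_integrand_def pi2_def periodic_extension_def inverse_mat_inverse_mat[OF v(1)]
      polar_part_hess_point_mult[OF n carrier v(2)] ..
  have chi: "chi_hat n d v * ?e (t + char_exponent n d v) = ?e t" for t
    unfolding chi_hat_def char_exponent_def[symmetric] exp_add[symmetric]
    by (simp add: algebra_simps)
  note T = distr_hess_shift[OF n, of v]
  note fH = schwartz_hess_point_bound(1)[OF n f]
  \<comment> \<open>A quotient with denominator \<open>0\<close> has the value \<open>0\<close> and is not shifted by the coefficient of \<open>v\<close>.\<close>
  have "AE x in ?M. (\<forall>k\<in>{..<n - 1}. x (1, k + 1, k) \<noteq> 0) \<and> x (2, 0, n - 1) \<noteq> 0"
    using finite_hess_vars
    by (intro AE_conjI AE_ball_countable' AE_PiM_lborel_neq) (auto simp: hess_vars_def)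
  then have AE: "AE x in ?M. f (hess_point n (?T x)) * ?e (whittaker_phase n d x)
      = chi_hat n d v * Psi_integrand n d f (?T x)"
  proof eventually_elim
    case (elim x)
    then have "whittaker_phase n d (?T x) = whittaker_phase n d x + char_exponent n d v"
      using n by (intro whittaker_phase_shift) auto
    then show ?case
      unfolding Psi_integrand_def by (simp only: mult.left_commute[of "chi_hat n d v"] chi)
  qed
  have PM: "Psi_integrand n d f \<in> borel_measurable ?M"
    by (intro borel_measurable_integrable integrable_Psi_integrand n f)
  have "pi2_dual n v (Psi' n d) f = (LINT x | ?M. f (hess_point n (?T x)) * ?e (whittaker_phase n d x))"
    by (simp only: pi2_dual_def Psi'_def integrand)
  also have "\<dots> = (LINT x | ?M. chi_hat n d v * Psi_integrand n d f (?T x))"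
    using measurable_compose[OF T(1) fH] measurable_compose[OF T(1) PM]
    by (intro integral_cong_AE AE borel_measurable_phase_mult n borel_measurable_times borel_measurable_const)
  also have "\<dots> = chi_hat n d v * (LINT x | ?M. Psi_integrand n d f (?T x))"
    by (rule integral_mult_right_zero)
  also have "(LINT x | ?M. Psi_integrand n d f (?T x)) = (LINT x | distr ?M ?M ?T. Psi_integrand n d f x)"
    by (rule integral_distr[OF T(1) PM, symmetric])
  also have "\<dots> = Psi' n d f"
    by (simp only: T(2) Psi'_def)
  finally show ?thesis .
qed

theorem mainTheorem12:
  fixes n :: nat and lam :: complex and d :: "real vec"
  assumes "n \<ge> 2" and "lam \<noteq> 0" and "d \<in> carrier_vec n"
  shows
    "(\<forall>f \<in> schwartz_eigenspace n lam.
        integrable (PiM (hess_vars n) (\<lambda>_. lborel)) (Psi_integrand n d f)) \<and>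
     linear_functional_on (schwartz_eigenspace n lam) (Psi' n d) \<and>
     (\<forall>v \<in> SL_fps n. lower_unipotent (coeff_mat 0 v) \<longrightarrow>
        (\<forall>f \<in> schwartz_eigenspace n lam.
           pi2_dual n v (Psi' n d) f = chi_hat n d v * Psi' n d f))"
proof -
  have schwartz: "f \<in> schwartz_space n" if "f \<in> schwartz_eigenspace n lam" for f
    using that by (simp add: schwartz_eigenspace_def)
  have int: "integrable (PiM (hess_vars n) (\<lambda>_. lborel)) (Psi_integrand n d f)"
    if "f \<in> schwartz_eigenspace n lam" for f
    by (intro integrable_Psi_integrand assms schwartz that)
  moreover have "linear_functional_on (schwartz_eigenspace n lam) (Psi' n d)"
    unfolding linear_functional_on_def
  proof (intro ballI allI)
    fix f g a b assume f: "f \<in> schwartz_eigenspace n lam" and g: "g \<in> schwartz_eigenspace n lam"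
    have "Psi_integrand n d (\<lambda>x. a * f x + b * g x)
        = (\<lambda>x. a * Psi_integrand n d f x + b * Psi_integrand n d g x)"
      by (simp add: Psi_integrand_def fun_eq_iff algebra_simps)
    then show "Psi' n d (\<lambda>x. a * f x + b * g x) = a * Psi' n d f + b * Psi' n d g"
      using int[OF f] int[OF g] by (simp add: Psi'_def)
  qed
  ultimately show ?thesis
    using Psi'_pi2_dual[OF assms(1)] schwartz by blast
qed

end
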